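(* Let $G(x,t)=\frac{1}{\sqrt{4\pi t}}e^{-|x|^2/(4t)}$ for $x\in\mathbb{R}$, $t>0$ be the one-dimensional heat kernel, and let $\hat G(x,s)=\int_0^\infty e^{-st}G(x,t)\,dt$. Then: (i) for $s>0$ and $x\in\mathbb{R}$, $\hat G(x,s)=\frac{1}{2\sqrt s}e^{-\sqrt s|x|}$; (ii) there is an absolute constant $C>0$ such that for every $0<\epsilon<0.1$ and every $T\ge 1000\delta>0$ there exist a positive integer $n\le C\log\frac{T}{\delta}\left(\log\frac1\epsilon+\log\log\frac{T}{\delta}\right)$, complex weights $w_k$ and complex nodes $s_k\in\mathbb{C}\setminus(-\infty,0]$ ($k=-n,\dots,n$) such that, with $$G_A(x,t)=\sum_{k=-n}^{n}w_k e^{s_k t}e^{-\sqrt{s_k}|x|},$$ one has $|G(x,t)-G_A(x,t)|<\frac{\epsilon}{\sqrt t}$ for all $x\in\mathbb{R}$ and all $t\in[\delta,T]$.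
   Context: $\sqrt{s}$ denotes the principal branch of the square root on $\mathbb{C}\setminus(-\infty,0]$. *)

theory Defs
  imports "HOL-Analysis.Analysis"
begin

definition heat_kernel :: "real \<Rightarrow> real \<Rightarrow> real" where
  "heat_kernel x t = exp (- (x\<^sup>2) / (4 * t)) / sqrt (4 * pi * t)"

definition heat_kernel_laplace :: "real \<Rightarrow> real \<Rightarrow> real" where
  "heat_kernel_laplace x s = (LBINT t:{0<..}. exp (- s * t) * heat_kernel x t)"

definition approx_kernel :: "nat \<Rightarrow> (int \<Rightarrow> complex) \<Rightarrow> (int \<Rightarrow> complex) \<Rightarrow> real \<Rightarrow> real \<Rightarrow> complex" where
  "approx_kernel n w s x t =
     (\<Sum>k\<in>{- int n..int n}. w k * exp (s k * of_real t) * exp (- csqrt (s k) * of_real \<bar>x\<bar>))"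

end

theory Submission
  imports Defs "HOL-Probability.Characteristic_Functions" "HOL-Complex_Analysis.Cauchy_Integral_Formula"
    "HOL-Real_Asymp.Real_Asymp"
begin

text \<open>For the approximation, substitute \<open>s = z\<^sup>2\<close> in the inverse Laplace integral: the heat kernel
  becomes \<open>1 / (2 \<pi> \<i>)\<close> times the integral of the entire function \<open>exp (z\<^sup>2 t - z |x|)\<close> over any
  vertical line in the right half plane. Being entire, the integrand has a primitive, so the part of
  a line between two conjugate points may be replaced by any polygon joining them. We take a polygon
  that starts at distance \<open>\<mu> = \<surd>(L / T)\<close> from the origin, where \<open>L = ln (1 / \<epsilon>)\<close>, and then follows a ray in the
  sector \<open>Re (z\<^sup>2) < 0 < Re z\<close> with geometrically growing steps up to distance about \<open>\<surd>(L / \<delta>)\<close>,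
  beyond which the integral is negligible. This needs \<open>O(log (T / \<delta>))\<close> steps. On a disc
  around each step the integrand is at most \<open>exp (O(L))\<close>, so \<open>m\<close> nodes per step give
  the error \<open>2\<^sup>-\<^sup>m exp (O(L)) / \<surd>t\<close>, and \<open>m = O(L + log log (T / \<delta>))\<close> nodes absorb both the
  exponential and the number of steps.\<close>

subsection \<open>The Laplace transform\<close>

text \<open>This \<Phi> is the error function scaled by \<surd>\<pi>/2. Its limit at infinity is
  half the Gaussian integral, and oddness transfers it to minus infinity.\<close>

lemma gauss_antiderivative:
  obtains \<Phi> :: "real \<Rightarrow> real"
  where "\<And>u. (\<Phi> has_real_derivative exp (- u\<^sup>2)) (at u)" and "\<Phi> 0 = 0"
    and "(\<Phi> \<longlongrightarrow> sqrt pi / 2) at_top" and "(\<Phi> \<longlongrightarrow> - (sqrt pi / 2)) at_bot"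
proof
  define \<Phi> where "\<Phi> u = (LBINT y=ereal 0..ereal u. exp (- y\<^sup>2))" for u :: real
  show "(\<Phi> has_real_derivative exp (- u\<^sup>2)) (at u)" for u
  proof -
    \<comment> \<open>The fundamental theorem yields a derivative within a closed interval; this one
      contains 0 and has \<open>u\<close> in its interior.\<close>
    let ?a = "- \<bar>u\<bar> - 1" and ?b = "\<bar>u\<bar> + 1"
    have "(\<Phi> has_vector_derivative exp (- u\<^sup>2)) (at u within {?a..?b})"
      unfolding \<Phi>_def
      by (rule interval_integral_FTC2) (auto intro!: continuous_intros)
    moreover have "at u within {?a..?b} = at u"
      by (rule at_within_Icc_at) auto
    ultimately show ?thesis by (simp add: has_real_derivative_iff_has_vector_derivative)
  qed
  show "\<Phi> 0 = 0" by (simp add: \<Phi>_def)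
  have odd: "\<Phi> (- u) = - \<Phi> u" for u
    unfolding \<Phi>_def
    by (subst interval_integral_reflect, subst interval_integral_endpoints_reverse) simp
  let ?g = "\<lambda>x::real. indicator {0..} x *\<^sub>R exp (- x\<^sup>2)"
  have g: "integrable lborel ?g" "integral\<^sup>L lborel ?g = sqrt pi / 2"
    using gaussian_moment_0 by (auto simp: has_bochner_integral_iff)
  have "((\<lambda>y. \<integral>x. indicator {..y} x *\<^sub>R ?g x \<partial>lborel) \<longlongrightarrow> sqrt pi / 2) at_top"
    using tendsto_integral_at_top[OF _ g(1)] unfolding g(2) by simp
  moreover have "\<forall>\<^sub>F y in at_top. (\<integral>x. indicator {..y} x *\<^sub>R ?g x \<partial>lborel) = \<Phi> y"
    using eventually_ge_at_top[of "0::real"]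
  proof eventually_elim
    case (elim y)
    then show ?case
      unfolding \<Phi>_def interval_integral_Icc[OF elim] set_lebesgue_integral_def
      by (intro Bochner_Integration.integral_cong) (auto split: split_indicator)
  qed
  ultimately show top: "(\<Phi> \<longlongrightarrow> sqrt pi / 2) at_top"
    using tendsto_cong by fastforce
  show "(\<Phi> \<longlongrightarrow> - (sqrt pi / 2)) at_bot"
    unfolding filterlim_at_bot_mirror odd by (intro tendsto_minus top)
qed

lemma heat_kernel_laplace_eq:
  fixes s x :: real
  assumes s: "s > 0"
  shows "heat_kernel_laplace x s = exp (- sqrt s * \<bar>x\<bar>) / (2 * sqrt s)"
proof -
  obtain \<Phi> where \<Phi>: "\<And>u. (\<Phi> has_real_derivative exp (- u\<^sup>2)) (at u)" "\<Phi> 0 = 0"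
    "(\<Phi> \<longlongrightarrow> sqrt pi / 2) at_top" "(\<Phi> \<longlongrightarrow> - (sqrt pi / 2)) at_bot"
    using gauss_antiderivative by metis
  define a b where "a = sqrt s" and "b = \<bar>x\<bar> / 2"
  have a: "a > 0" and b: "b \<ge> 0" using s by (auto simp: a_def b_def)
  have s2: "s = a\<^sup>2" using s by (simp add: a_def)
  have x2: "x\<^sup>2 = 4 * b\<^sup>2" by (simp add: b_def power_divide)
  \<comment> \<open>With \<open>erf = 2 \<Phi> / \<surd>\<pi>\<close> this is the classical antiderivative of \<open>exp (- a\<^sup>2 u\<^sup>2 - b\<^sup>2 / u\<^sup>2)\<close> after \<open>t = u\<^sup>2\<close>.\<close>
  define H where "H t = (exp (2 * a * b) * \<Phi> (a * sqrt t + b / sqrt t)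
     + exp (- (2 * a * b)) * \<Phi> (a * sqrt t - b / sqrt t)) / (2 * a * sqrt pi)" for t
  have H: "(H has_real_derivative exp (- s * t) * heat_kernel x t) (at t)" if t: "t > 0" for t
  proof -
    define r where "r = sqrt t"
    have r: "r > 0" and tr: "t = r\<^sup>2" using t by (auto simp: r_def)
    have r': "sqrt (r\<^sup>2) = r" using r by simp
    \<comment> \<open>The prefactors cancel the cross terms of the squares, so both summands of
      \<open>H\<close> carry the same Gaussian and the \<plusminus>\<open>b / (2 * r ^ 3)\<close>
      parts of the inner derivatives cancel.\<close>
    have e1: "exp (2 * a * b) * exp (- (a * r + b / r)\<^sup>2) = exp (- (a\<^sup>2 * r\<^sup>2) - b\<^sup>2 / r\<^sup>2)"
      using r by (simp flip: exp_add) (simp add: field_simps power2_eq_square)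
    have e2: "exp (- (2 * a * b)) * exp (- (a * r - b / r)\<^sup>2) = exp (- (a\<^sup>2 * r\<^sup>2) - b\<^sup>2 / r\<^sup>2)"
      using r by (simp flip: exp_add) (simp add: field_simps power2_eq_square)
    have "(H has_real_derivative
       (exp (2 * a * b) * (exp (- (a * r + b / r)\<^sup>2) * (a / (2 * r) - b / (2 * r ^ 3)))
      + exp (- (2 * a * b)) * (exp (- (a * r - b / r)\<^sup>2) * (a / (2 * r) + b / (2 * r ^ 3))))
        / (2 * a * sqrt pi)) (at t)"
      unfolding H_def tr using r a
      by (auto intro!: derivative_eq_intros DERIV_chain2[OF \<Phi>(1)] simp: r')
         (auto simp: field_simps power2_eq_square power3_eq_cube)
    also have "(exp (2 * a * b) * (exp (- (a * r + b / r)\<^sup>2) * (a / (2 * r) - b / (2 * r ^ 3)))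
      + exp (- (2 * a * b)) * (exp (- (a * r - b / r)\<^sup>2) * (a / (2 * r) + b / (2 * r ^ 3))))
        / (2 * a * sqrt pi) = exp (- (a\<^sup>2 * r\<^sup>2) - b\<^sup>2 / r\<^sup>2) / (2 * sqrt pi * r)"
      unfolding mult.assoc[symmetric] e1 e2 using a r by (simp add: field_simps)
    also have "\<dots> = exp (- s * t) * heat_kernel x t"
    proof -
      have "exp (- s * t) * exp (- (x\<^sup>2) / (4 * t)) = exp (- (a\<^sup>2 * r\<^sup>2) - b\<^sup>2 / r\<^sup>2)"
        unfolding s2 x2 tr using r by (simp flip: exp_add)
      then show ?thesis
        unfolding heat_kernel_def times_divide_eq_right using r by (simp add: tr real_sqrt_mult)
    qed
    finally show ?thesis .
  qed
  have top: "(H \<longlongrightarrow> (exp (2 * a * b) * (sqrt pi / 2) + exp (- (2 * a * b)) * (sqrt pi / 2)) / (2 * a * sqrt pi)) at_top"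
    unfolding H_def
  proof (intro tendsto_intros filterlim_compose[OF \<Phi>(3)])
    show "filterlim (\<lambda>t. a * sqrt t + b / sqrt t) at_top at_top"
      using a by real_asymp
    show "filterlim (\<lambda>t. a * sqrt t - b / sqrt t) at_top at_top"
      using a by real_asymp
  qed (use a in auto)
  \<comment> \<open>For \<open>b > 0\<close> the arguments of \<Phi> tend to plus and minus
    infinity. For \<open>b = 0\<close> both tend to 0, and the same formula holds because its two
    exponentials coincide.\<close>
  have right0: "(H \<longlongrightarrow> (exp (2 * a * b) * (sqrt pi / 2) - exp (- (2 * a * b)) * (sqrt pi / 2)) / (2 * a * sqrt pi)) (at_right 0)"
  proof (cases "b = 0")
    case False
    then have b: "b > 0" using b by simp
    have "(H \<longlongrightarrow> (exp (2 * a * b) * (sqrt pi / 2) + exp (- (2 * a * b)) * (- (sqrt pi / 2))) / (2 * a * sqrt pi)) (at_right 0)"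
      unfolding H_def
    proof (intro tendsto_intros filterlim_compose[OF \<Phi>(3)] filterlim_compose[OF \<Phi>(4)])
      show "filterlim (\<lambda>t. a * sqrt t + b / sqrt t) at_top (at_right 0)"
        using b by real_asymp
      show "filterlim (\<lambda>t. a * sqrt t - b / sqrt t) at_bot (at_right 0)"
        using b by real_asymp
    qed (use a in auto)
    then show ?thesis by simp
  next
    case True
    have "isCont \<Phi> (a * sqrt 0)" using \<Phi>(1) DERIV_isCont by blast
    moreover have "((\<lambda>t. a * sqrt t) \<longlongrightarrow> a * sqrt 0) (at_right 0)"
      by (intro tendsto_intros)
    ultimately have "((\<lambda>t. \<Phi> (a * sqrt t)) \<longlongrightarrow> \<Phi> (a * sqrt 0)) (at_right 0)"
      by (rule isCont_tendsto_compose)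
    then have "((\<lambda>t. (\<Phi> (a * sqrt t) + \<Phi> (a * sqrt t)) / (2 * a * sqrt pi))
        \<longlongrightarrow> (\<Phi> (a * sqrt 0) + \<Phi> (a * sqrt 0)) / (2 * a * sqrt pi)) (at_right 0)"
      using a by (intro tendsto_intros) auto
    then show ?thesis by (simp add: H_def[abs_def] True \<Phi>(2))
  qed
  have "(LBINT t=ereal 0..\<infinity>. exp (- s * t) * heat_kernel x t)
     = (exp (2 * a * b) * (sqrt pi / 2) + exp (- (2 * a * b)) * (sqrt pi / 2)) / (2 * a * sqrt pi)
       - (exp (2 * a * b) * (sqrt pi / 2) - exp (- (2 * a * b)) * (sqrt pi / 2)) / (2 * a * sqrt pi)"
  \<comment> \<open>Nonnegativity of the integrand spares a separate proof of integrability.\<close>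
  proof (rule interval_integral_FTC_nonneg(2))
    show "isCont (\<lambda>t. exp (- s * t) * heat_kernel x t) t" if "ereal 0 < ereal t" for t
      unfolding heat_kernel_def using that by (intro continuous_intros) auto
    show "AE t in lborel. ereal 0 < ereal t \<longrightarrow> ereal t < \<infinity> \<longrightarrow> 0 \<le> exp (- s * t) * heat_kernel x t"
      by (auto simp: heat_kernel_def)
  qed (use H top right0 in \<open>auto simp: ereal_tendsto_simps\<close>)
  also have "\<dots> = exp (- (2 * a * b)) / (2 * a)"
    using a by (simp add: field_simps)
  also have "2 * a * b = sqrt s * \<bar>x\<bar>" by (simp add: a_def b_def)
  finally show ?thesis
    unfolding heat_kernel_laplace_def interval_integral_to_infinity_eq by (simp add: a_def)
qed

subsection \<open>Quadrature on a disc\<close>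

text \<open>Discrete Fourier orthogonality: off the diagonal the terms are the powers of an
  \<open>m\<close>-th root of unity \<open>z\<close> other than 1, and their geometric sum
  vanishes.\<close>

lemma sum_cis_orthogonal:
  fixes i j m :: nat
  assumes "i < m" "j < m"
  shows "(\<Sum>k<m. cis (2 * pi * k / m) ^ i * cis (- (2 * pi * k / m)) ^ j)
           = (if i = j then of_nat m else 0)"
proof (cases "i = j")
  case True
  have "cis a ^ j * cis (- a) ^ j = 1" for a
    by (simp flip: power_mult_distrib add: cis_mult)
  then show ?thesis using True by simp
next
  case False
  define z where "z = cis (2 * pi * (real i - real j) / m)"
  have m: "m > 0" using assms by simp
  have eq: "cis (2 * pi * k / m) ^ i * cis (- (2 * pi * k / m)) ^ j = z ^ k" for k :: nat
    unfolding z_def Complex.DeMoivre cis_mult using m by (intro arg_cong[of _ _ cis]) (simp add: divide_simps algebra_simps)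
  have "z ^ m = cis (2 * pi * (real i - real j))"
    unfolding z_def Complex.DeMoivre using m by simp
  also have "\<dots> = 1"
    using cis_multiple_2pi[of "real i - real j"] by (simp add: mult_ac)
  finally have zm: "z ^ m = 1" .
  \<comment> \<open>Otherwise \<open>m\<close> would divide \<open>i - j\<close>, which is nonzero
    and smaller than \<open>m\<close> in absolute value.\<close>
  have "z \<noteq> 1"
  proof
    assume "z = 1"
    then have "cos (2 * pi * (real i - real j) / m) = 1"
      by (simp add: z_def cis.ctr complex_eq_iff)
    then obtain q :: int where "2 * pi * (real i - real j) / m = real_of_int q * 2 * pi"
      by (auto simp: cos_one_2pi_int)
    then have "(2 * pi) * (real i - real j) = (2 * pi) * (q * m)" using m by (simp add: field_simps)
    then have "real i - real j = q * m" by (simp only: mult_cancel_left) simp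
    then have "real_of_int (int i - int j) = real_of_int (q * int m)" by simp
    then have "int i - int j = q * int m" by linarith
    then have d: "int m dvd int i - int j" by simp
    then have "int m \<le> \<bar>int i - int j\<bar>" using False by (intro zdvd_imp_le) auto
    then show False using assms by linarith
  qed
  then show ?thesis using False zm by (simp add: eq sum_gp_strict)
qed

text \<open>The weights integrate the monomials of degree below \<open>m\<close> exactly from \<open>z\<close> to \<open>z + b\<close>.
  Sampling at half the radius of the disc of holomorphy makes the Taylor remainder
  \<open>O(2\<^sup>-\<^sup>m)\<close> at the nodes, while \<open>|b| \<le> r / 2\<close> keeps the sum of the \<open>|w k|\<close> below \<open>2 |b|\<close>,
  independently of \<open>m\<close>.\<close>

lemma disc_quadrature:
  fixes z b :: complex and m :: nat
  assumes m: "m > 0" and r: "r > 0" and b: "cmod b \<le> r / 2"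
  shows "\<exists>w :: nat \<Rightarrow> complex. \<forall>f F M. f holomorphic_on cball z (2 * r) \<longrightarrow>
           (\<forall>\<zeta>\<in>cball z (2 * r). (F has_field_derivative f \<zeta>) (at \<zeta>)) \<longrightarrow>
           (\<forall>\<zeta>\<in>cball z (2 * r). cmod (f \<zeta>) \<le> M) \<longrightarrow>
           cmod (F (z + b) - F z - (\<Sum>k<m. w k * f (z + r * cis (2 * pi * real k / m))))
             \<le> 6 * cmod b * M / 2 ^ m"
proof -
  \<comment> \<open>The inverse discrete Fourier transform recovers the coefficient of degree
    \<open>j\<close> from the samples, and \<open>b ^ Suc j / of_nat (Suc j)\<close> is the integral
    of that monomial along the step. The weights do not depend on the integrand.\<close>
  define w where "w k = (1 / of_nat m) * (\<Sum>j<m. b ^ Suc j / of_nat (Suc j) / of_real r ^ j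
      * cis (- (2 * pi * k / m)) ^ j)" for k :: nat
  have wb: "cmod (w k) \<le> 2 * cmod b / m" for k
  proof -
    have "cmod (\<Sum>j<m. b ^ Suc j / of_nat (Suc j) / of_real r ^ j * cis (- (2 * pi * k / m)) ^ j)
       \<le> (\<Sum>j<m. cmod b * (1/2) ^ j)"
    proof (rule sum_norm_le)
      fix j
      have "cmod (b ^ Suc j / of_nat (Suc j) / of_real r ^ j * cis (- (2 * pi * k / m)) ^ j)
         = cmod b * (cmod b / r) ^ j / Suc j"
        using r by (simp add: norm_mult norm_divide norm_power power_divide flip: of_nat_Suc)
      also have "\<dots> \<le> cmod b * (cmod b / r) ^ j"
        using r by (intro divide_left_mono[of 1, simplified]) auto
      also have "\<dots> \<le> cmod b * (1/2) ^ j"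
        using r b by (intro mult_left_mono power_mono) (auto simp: field_simps)
      finally show "cmod (b ^ Suc j / of_nat (Suc j) / of_real r ^ j * cis (- (2 * pi * k / m)) ^ j)
         \<le> cmod b * (1/2) ^ j" .
    qed
    also have "\<dots> = cmod b * (\<Sum>j<m. (1/2) ^ j)" by (simp add: sum_distrib_left)
    also have "\<dots> \<le> cmod b * 2"
      by (intro mult_left_mono) (auto simp: sum_gp_strict)
    finally show ?thesis unfolding w_def using m by (simp add: norm_mult norm_divide field_simps)
  qed
  have wexact: "(\<Sum>k<m. w k * (r * cis (2 * pi * k / m)) ^ i) = b ^ Suc i / of_nat (Suc i)"
    if "i < m" for i
  proof -
    have "(\<Sum>k<m. w k * (r * cis (2 * pi * k / m)) ^ i)
      = (\<Sum>k<m. \<Sum>j<m. (1 / of_nat m) * (b ^ Suc j / of_nat (Suc j) / of_real r ^ j) * of_real r ^ i *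
           (cis (2 * pi * k / m) ^ i * cis (- (2 * pi * k / m)) ^ j))"
      unfolding w_def sum_distrib_left sum_distrib_right power_mult_distrib
      by (intro sum.cong refl) (simp only: mult_ac)
    also have "\<dots> = (\<Sum>j<m. (1 / of_nat m) * (b ^ Suc j / of_nat (Suc j) / of_real r ^ j) * of_real r ^ i *
           (\<Sum>k<m. cis (2 * pi * k / m) ^ i * cis (- (2 * pi * k / m)) ^ j))"
      by (subst sum.swap) (simp only: sum_distrib_left)
    also have "\<dots> = (\<Sum>j<m. if i = j then b ^ Suc i / of_nat (Suc i) else 0)"
      using that m r by (intro sum.cong refl) (simp add: sum_cis_orthogonal del: of_nat_Suc)
    also have "\<dots> = b ^ Suc i / of_nat (Suc i)" using that by simp
    finally show ?thesis .
  qed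
  show ?thesis
  proof (intro exI[of _ w] allI impI)
    fix f F M
    assume f: "f holomorphic_on cball z (2 * r)"
      and F: "\<forall>\<zeta>\<in>cball z (2 * r). (F has_field_derivative f \<zeta>) (at \<zeta>)"
      and M: "\<forall>\<zeta>\<in>cball z (2 * r). cmod (f \<zeta>) \<le> M"
    define c where "c n = (deriv ^^ n) f z / fact n" for n
    define p where "p \<zeta> = (\<Sum>n<m. c n * (\<zeta> - z) ^ n)" for \<zeta>
    define P where "P \<zeta> = (\<Sum>n<m. c n * ((\<zeta> - z) ^ Suc n / of_nat (Suc n)))" for \<zeta>
    have M0: "M \<ge> 0" using M r norm_ge_zero order_trans by (metis centre_in_cball less_imp_le mult_nonneg_nonneg zero_le_numeral)
    have fb: "f holomorphic_on ball z (2 * r)" using f ball_subset_cball holomorphic_on_subset by blast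
    have cb: "cmod (c n) \<le> M / (2 * r) ^ n" for n
    proof -
      have "cmod ((deriv ^^ n) f z) \<le> fact n * M / (2 * r) ^ n"
        by (rule Cauchy_inequality[OF fb holomorphic_on_imp_continuous_on[OF f]])
          (use r M in \<open>auto simp: dist_norm norm_minus_commute\<close>)
      then show ?thesis by (simp add: c_def norm_divide field_simps)
    qed
    \<comment> \<open>Cauchy's estimate on radius \<open>2 * r\<close> against powers of a distance
      at most \<open>r\<close> leaves a geometric tail of ratio 1/2.\<close>
    have rem: "cmod (f \<zeta> - p \<zeta>) \<le> 2 * M / 2 ^ m" if z: "cmod (\<zeta> - z) \<le> r" for \<zeta>
    proof -
      have "\<zeta> \<in> ball z (2 * r)" using z r by (simp add: dist_norm norm_minus_commute)
      then have s: "(\<lambda>n. c n * (\<zeta> - z) ^ n) sums f \<zeta>"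
        unfolding c_def by (rule holomorphic_power_series[OF fb])
      then have s2: "(\<lambda>n. c (n + m) * (\<zeta> - z) ^ (n + m)) sums (f \<zeta> - p \<zeta>)"
        unfolding p_def by (subst sums_iff_shift) simp
      have g: "(\<lambda>n. M * (1/2) ^ m * (1/2) ^ n) sums (M * (1/2) ^ m * (1 / (1 - 1/2)))"
        by (intro sums_mult geometric_sums) simp
      have "cmod (f \<zeta> - p \<zeta>) \<le> (\<Sum>n. M * (1/2) ^ m * (1/2) ^ n)"
        unfolding sums_unique[OF s2]
      proof (rule norm_suminf_le[OF _ sums_summable[OF g]])
        fix n
        have "cmod (c (n + m) * (\<zeta> - z) ^ (n + m)) \<le> M / (2 * r) ^ (n + m) * r ^ (n + m)"
          unfolding norm_mult norm_power
          using z r M0 by (intro mult_mono cb power_mono) auto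
        also have "\<dots> = M * (1/2) ^ m * (1/2) ^ n"
          using r by (simp add: power_add power_mult_distrib field_simps)
        finally show "cmod (c (n + m) * (\<zeta> - z) ^ (n + m)) \<le> M * (1/2) ^ m * (1/2) ^ n" .
      qed
      also have "\<dots> = 2 * M / 2 ^ m"
        unfolding sums_unique[OF g, symmetric] by (simp add: power_divide)
      finally show ?thesis .
    qed
    have Pd: "(P has_field_derivative p \<zeta>) (at \<zeta>)" for \<zeta>
      unfolding P_def p_def
      by (rule derivative_eq_intros refl | simp add: mult.commute del: of_nat_Suc power_Suc)+
    have 1: "cmod ((F (z + b) - P (z + b)) - (F z - P z)) \<le> 2 * M / 2 ^ m * cmod (z + b - z)"
    proof (rule field_differentiable_bound[of "cball z r"])
      fix \<zeta> assume "\<zeta> \<in> cball z r"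
      then show "((\<lambda>\<zeta>. F \<zeta> - P \<zeta>) has_field_derivative f \<zeta> - p \<zeta>) (at \<zeta> within cball z r)"
        using r by (intro has_field_derivative_at_within[OF DERIV_diff] Pd F[rule_format]) auto
      show "cmod (f \<zeta> - p \<zeta>) \<le> 2 * M / 2 ^ m"
        using \<open>\<zeta> \<in> cball z r\<close> by (intro rem) (auto simp: dist_norm norm_minus_commute)
    qed (use b r in \<open>auto simp: dist_norm norm_minus_commute\<close>)
    have Pz: "P z = 0" by (simp add: P_def)
    have Pb: "P (z + b) = (\<Sum>k<m. w k * p (z + r * cis (2 * pi * k / m)))"
    proof -
      have "(\<Sum>k<m. w k * p (z + r * cis (2 * pi * k / m)))
         = (\<Sum>k<m. \<Sum>i<m. c i * (w k * (r * cis (2 * pi * k / m)) ^ i))"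
        unfolding p_def sum_distrib_left by (intro sum.cong refl) simp
      also have "\<dots> = (\<Sum>i<m. c i * (\<Sum>k<m. w k * (r * cis (2 * pi * k / m)) ^ i))"
        by (subst sum.swap) (simp only: sum_distrib_left)
      also have "\<dots> = P (z + b)"
        unfolding P_def by (intro sum.cong refl) (simp add: wexact del: of_nat_Suc power_Suc)
      finally show ?thesis by simp
    qed
    have 2: "cmod (\<Sum>k<m. w k * (f (z + r * cis (2 * pi * k / m)) - p (z + r * cis (2 * pi * k / m))))
        \<le> (\<Sum>k<m. 2 * cmod b / m * (2 * M / 2 ^ m))"
    proof (rule sum_norm_le)
      fix k
      show "cmod (w k * (f (z + r * cis (2 * pi * k / m)) - p (z + r * cis (2 * pi * k / m))))
         \<le> 2 * cmod b / m * (2 * M / 2 ^ m)"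
        unfolding norm_mult using r by (intro mult_mono wb rem) (auto simp: norm_mult)
    qed
    \<comment> \<open>The rule is exact on \<open>p\<close>, so only the remainder
      \<open>f - p\<close> counts: its integral contributes 2 and its samples, with weights of total
      size at most \<open>2 * cmod b\<close>, contribute 4 to the factor 6.\<close>
    have "F (z + b) - F z - (\<Sum>k<m. w k * f (z + r * cis (2 * pi * k / m)))
       = ((F (z + b) - P (z + b)) - (F z - P z))
         - (\<Sum>k<m. w k * (f (z + r * cis (2 * pi * k / m)) - p (z + r * cis (2 * pi * k / m))))"
      by (simp add: Pz Pb right_diff_distrib sum_subtractf)
    also have "cmod \<dots> \<le> 2 * M / 2 ^ m * cmod b + (\<Sum>k<m. 2 * cmod b / m * (2 * M / 2 ^ m))"
      using norm_triangle_ineq4[THEN order_trans, OF add_mono[OF 1 2]] by simp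
    also have "\<dots> = 6 * cmod b * M / 2 ^ m" using m by (simp add: field_simps)
    finally show "cmod (F (z + b) - F z - (\<Sum>k<m. w k * f (z + r * cis (2 * pi * real k / m))))
             \<le> 6 * cmod b * M / 2 ^ m" .
  qed
qed

subsection \<open>The heat kernel as a contour integral\<close>

text \<open>After rescaling \<open>y\<close> by \<open>sqrt (2 * t)\<close> the integral is the real
  part of the characteristic function of the standard normal distribution.\<close>

lemma
  fixes t \<beta> :: real
  assumes t: "t > 0"
  shows integrable_gauss_cos: "integrable lborel (\<lambda>y. exp (- t * y\<^sup>2) * cos (\<beta> * y))"
    and integral_gauss_cos:
      "(LINT y|lborel. exp (- t * y\<^sup>2) * cos (\<beta> * y)) = sqrt (pi / t) * exp (- \<beta>\<^sup>2 / (4 * t))"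
proof -
  define \<sigma> where "\<sigma> = 1 / sqrt (2 * t)"
  have \<sigma>: "\<sigma> > 0" "\<sigma>\<^sup>2 = 1 / (2 * t)" using t by (auto simp: \<sigma>_def power_divide)
  have "integrable lborel (\<lambda>y. sqrt (2 * pi * \<sigma>\<^sup>2) * normal_density 0 \<sigma> y)"
    using \<sigma> by (intro integrable_mult_right integrable_normal_density)
  also have "(\<lambda>y. sqrt (2 * pi * \<sigma>\<^sup>2) * normal_density 0 \<sigma> y) = (\<lambda>y. exp (- t * y\<^sup>2))"
    using t by (auto simp: normal_density_def \<sigma>(2) field_simps)
  finally have "integrable lborel (\<lambda>y. exp (- t * y\<^sup>2))" .
  then show int: "integrable lborel (\<lambda>y. exp (- t * y\<^sup>2) * cos (\<beta> * y))"
    by (rule Bochner_Integration.integrable_bound) (auto simp: abs_mult mult_le_cancel_left1)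
  let ?v = "\<beta> / sqrt (2 * t)"
  let ?N = std_normal_distribution
  interpret real_distribution ?N by (rule real_dist_normal_dist)
  have "integrable ?N (\<lambda>x. iexp (?v * x))"
    by (rule integrable_const_bound[of _ 1]) auto
  from integral_Re[OF this] have "(LINT x|?N. cos (?v * x)) = Re (char ?N ?v)"
    unfolding char_def by (simp only: Re_exp) simp
  also have "\<dots> = exp (- ?v\<^sup>2 / 2)" by (simp add: char_std_normal_distribution Re_exp flip: exp_of_real)
  finally have "exp (- ?v\<^sup>2 / 2) = (LINT x|lborel. std_normal_density x * cos (?v * x))"
    by (subst (asm) integral_density) auto
  also have "\<dots> = sqrt (2 * t) * (LINT y|lborel. std_normal_density (sqrt (2 * t) * y) * cos (?v * (sqrt (2 * t) * y)))"
    using t by (subst lborel_integral_real_affine[of "sqrt (2 * t)" _ 0]) auto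
  also have "\<dots> = sqrt (2 * t) * (LINT y|lborel. 1 / sqrt (2 * pi) * (exp (- t * y\<^sup>2) * cos (\<beta> * y)))"
    using t by (simp add: std_normal_density_def power_mult_distrib)
  also have "\<dots> = sqrt (2 * t) / sqrt (2 * pi) * (LINT y|lborel. exp (- t * y\<^sup>2) * cos (\<beta> * y))"
    by (subst integral_mult_right_zero) simp
  also have "sqrt (2 * t) / sqrt (2 * pi) = sqrt t / sqrt pi"
    by (simp add: real_sqrt_mult)
  also have "- ?v\<^sup>2 / 2 = - \<beta>\<^sup>2 / (4 * t)" using t by (simp add: power_divide)
  finally have "exp (- \<beta>\<^sup>2 / (4 * t)) = sqrt t / sqrt pi * (LINT y|lborel. exp (- t * y\<^sup>2) * cos (\<beta> * y))" .
  then show "(LINT y|lborel. exp (- t * y\<^sup>2) * cos (\<beta> * y)) = sqrt (pi / t) * exp (- \<beta>\<^sup>2 / (4 * t))"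
    using t by (simp add: real_sqrt_divide)
qed

text \<open>Up to the factor \<open>2 \<pi>\<close> the heat kernel is the integral of the real part of the integrand over
  the vertical line through \<open>\<rho> (3 + 4 \<i>)\<close>. The part between the real axis and this point is a
  difference of values of \<open>F\<close>, and beyond it \<open>|exp (z\<^sup>2 t)|\<close> is already tiny because the slope \<open>4/3\<close>
  exceeds 1. The point \<open>u\<close> is arbitrary since \<open>Im F\<close> is constant on the real axis.\<close>

lemma heat_kernel_tail:
  fixes t x \<rho> :: real and F :: "complex \<Rightarrow> complex"
  assumes t: "t > 0" and \<rho>: "\<rho> > 0"
    and F: "\<And>z::complex. (F has_field_derivative exp (z\<^sup>2 * t - z * \<bar>x\<bar>)) (at z)"
  shows "\<bar>heat_kernel x t - Im (F (\<rho> * Complex 3 4) - F (of_real u)) / pi\<bar> \<le> exp (- 3 * \<rho>\<^sup>2 * t) / sqrt (pi * t)"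
proof -
  define c Y X \<beta> where "c = 3 * \<rho>" and "Y = 4 * \<rho>" and "X = \<bar>x\<bar>" and "\<beta> = 2 * c * t - X"
  have cY: "c > 0" "Y > 0" and X: "X \<ge> 0" using \<rho> by (auto simp: c_def Y_def X_def)
  \<comment> \<open>With dz = \<i> dy on the line Re z = \<open>c\<close>, the increments of Im
    \<open>F\<close> are integrals of the real part of the integrand, which is
    \<open>g\<close>.\<close>
  define g where "g y = exp (c\<^sup>2 * t - c * X) * (exp (- t * y\<^sup>2) * cos (\<beta> * y))" for y
  have g_Re: "Re (exp ((Complex c y)\<^sup>2 * t - Complex c y * X)) = g y" for y
  proof -
    have "Re ((Complex c y)\<^sup>2 * t - Complex c y * X) = (c\<^sup>2 * t - c * X) + - t * y\<^sup>2"
      "Im ((Complex c y)\<^sup>2 * t - Complex c y * X) = \<beta> * y"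
      by (simp_all add: \<beta>_def power2_eq_square algebra_simps)
    then show ?thesis by (simp only: Re_exp exp_add g_def mult.assoc)
  qed
  have gi: "integrable lborel g"
    unfolding g_def by (intro integrable_mult_right integrable_gauss_cos t)
  have g_full: "(LINT y|lborel. g y) = 2 * pi * heat_kernel x t"
  proof -
    have "(LINT y|lborel. g y) = sqrt (pi / t) * (exp (c\<^sup>2 * t - c * X) * exp (- \<beta>\<^sup>2 / (4 * t)))"
      unfolding g_def by (subst integral_mult_right_zero) (simp add: integral_gauss_cos[OF t, simplified])
    \<comment> \<open>Completing the square removes \<open>c\<close>: the integral does not depend
      on the chosen vertical line.\<close>
    also have "exp (c\<^sup>2 * t - c * X) * exp (- \<beta>\<^sup>2 / (4 * t)) = exp (- X\<^sup>2 / (4 * t))"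
      using t by (simp flip: exp_add) (simp add: \<beta>_def field_simps power2_eq_square)
    also have "sqrt (pi / t) * \<dots> = 2 * pi * heat_kernel x t"
      using t by (simp add: heat_kernel_def X_def real_sqrt_mult real_sqrt_divide field_simps)
    finally show ?thesis .
  qed
  have sint: "set_integrable lborel A g" if "A \<in> sets borel" for A
    using integrable_mult_indicator[OF _ gi, of A] that by (simp add: set_integrable_def)
  have g_half: "(LBINT y:{0..}. g y) = pi * heat_kernel x t"
  proof -
    have "has_bochner_integral lborel (\<lambda>y. indicator {0..} y *\<^sub>R g y) (LBINT y:{0..}. g y)"
      using sint[of "{0..}"] unfolding set_integrable_def set_lebesgue_integral_def
      by (simp add: has_bochner_integral_integrable)
    moreover have "g (- y) = g y" for y by (simp add: g_def)
    ultimately have "(LINT y|lborel. g y) = 2 *\<^sub>R (LBINT y:{0..}. g y)"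
      by (rule has_bochner_integral_integral_eq[OF has_bochner_integral_even_function])
    then show ?thesis using g_full by simp
  qed
  have g_main: "(LBINT y:{0..Y}. g y) = Im (F (Complex c Y)) - Im (F (Complex c 0))"
  proof -
    have "(LBINT y=ereal 0..ereal Y. g y) = Im (F (Complex c Y)) - Im (F (Complex c 0))"
    proof (rule interval_integral_FTC_finite)
      show "continuous_on {min 0 Y..max 0 Y} g" unfolding g_def by (intro continuous_intros)
      fix y
      have "((\<lambda>y. Complex c y) has_vector_derivative \<i>) (at y)"
        unfolding Complex_eq by (auto intro!: derivative_eq_intros)
      from field_vector_diff_chain_at[OF this F]
      have "((\<lambda>y. F (Complex c y)) has_vector_derivative \<i> * exp ((Complex c y)\<^sup>2 * t - Complex c y * X)) (at y)"
        by (simp add: o_def X_def)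
      from bounded_linear.has_vector_derivative[OF bounded_linear_Im this]
      show "((\<lambda>y. Im (F (Complex c y))) has_vector_derivative g y) (at y within {min 0 Y..max 0 Y})"
        unfolding Im_i_times g_Re by (rule has_vector_derivative_at_within)
    qed
    then show ?thesis using cY by (simp add: interval_integral_Icc)
  qed
  have real_axis: "Im (F (of_real v)) = Im (F (of_real u))" for v :: real
  proof (rule DERIV_isconst_all[of "\<lambda>y. Im (F (of_real y))", rule_format])
    fix y :: real
    have "((\<lambda>y. complex_of_real y) has_vector_derivative 1) (at y)"
      by (auto intro!: derivative_eq_intros)
    from field_vector_diff_chain_at[OF this F]
    have "((\<lambda>y. F (of_real y)) has_vector_derivative exp ((complex_of_real y)\<^sup>2 * t - of_real y * \<bar>x\<bar>)) (at y)"
      by (simp add: o_def)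
    from bounded_linear.has_vector_derivative[OF bounded_linear_Im this]
    show "((\<lambda>y. Im (F (of_real y))) has_real_derivative 0) (at y)"
      by (simp add: has_real_derivative_iff_has_vector_derivative Im_exp)
  qed
  have split: "(LBINT y:{0..}. g y) = (LBINT y:{0..Y}. g y) + (LBINT y:{Y<..}. g y)"
  proof -
    have "{0..} = {0..Y} \<union> {Y<..}" using cY by auto
    then show ?thesis by (simp only:) (intro set_integral_Un sint; auto)
  qed
  have tail: "\<bar>LBINT y:{Y<..}. g y\<bar> \<le> exp (- 3 * \<rho>\<^sup>2 * t) * sqrt (pi / t)"
  proof -
    \<comment> \<open>Of the decay \<open>exp (- t * y\<^sup>2)\<close> a quarter is kept for
      integrability. For \<open>y > Y\<close> the other three quarters give
      \<open>12 * \<rho>\<^sup>2 * t\<close>, which beats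
      \<open>c\<^sup>2 * t = 9 * \<rho>\<^sup>2 * t\<close> by
      \<open>3 * \<rho>\<^sup>2 * t\<close>. The factor \<open>cos (0 * y)\<close> matches the form
      of the Gaussian cosine integral.\<close>
    let ?h = "\<lambda>y. exp (- 3 * \<rho>\<^sup>2 * t) * (exp (- (t / 4) * y\<^sup>2) * cos (0 * y))"
    let ?k = "\<lambda>y. indicator {0..} y *\<^sub>R ?h y"
    have h: "integrable lborel ?h"
      by (intro integrable_mult_right integrable_gauss_cos) (use t in simp)
    have k: "integrable lborel ?k" using h integrable_mult_indicator[of "{0..}" lborel ?h] by simp
    have hv: "(LINT y|lborel. ?h y) = exp (- 3 * \<rho>\<^sup>2 * t) * (2 * sqrt (pi / t))"
      using integral_gauss_cos[of "t / 4" 0] t by (simp add: real_sqrt_mult real_sqrt_divide)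
    have "has_bochner_integral lborel (\<lambda>y. indicator {0..} y *\<^sub>R ?h y) (LINT y|lborel. ?k y)"
      using k by (simp add: has_bochner_integral_integrable)
    moreover have "?h (- y) = ?h y" for y by simp
    ultimately have "(LINT y|lborel. ?h y) = 2 *\<^sub>R (LINT y|lborel. ?k y)"
      by (rule has_bochner_integral_integral_eq[OF has_bochner_integral_even_function])
    then have kv: "(LINT y|lborel. ?k y) = exp (- 3 * \<rho>\<^sup>2 * t) * sqrt (pi / t)"
      unfolding hv by simp
    have "norm (LINT y|lborel. indicator {Y<..} y *\<^sub>R g y) \<le> (LINT y|lborel. ?k y)"
    proof (rule Bochner_Integration.integral_norm_bound_integral)
      show "integrable lborel (\<lambda>y. indicator {Y<..} y *\<^sub>R g y)"
        using sint[of "{Y<..}"] by (simp add: set_integrable_def)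
      fix y
      show "norm (indicator {Y<..} y *\<^sub>R g y) \<le> ?k y"
      proof (cases "y > Y")
        case True
        then have y: "y \<ge> 0" using cY by simp
        have "Y\<^sup>2 \<le> y\<^sup>2" using True cY by (intro power_mono) auto
        then have "3 / 4 * (16 * \<rho>\<^sup>2) * t \<le> 3 / 4 * y\<^sup>2 * t"
          using t by (intro mult_right_mono) (auto simp: Y_def power_mult_distrib)
        moreover have "c * X \<ge> 0" using cY X by simp
        moreover have c2: "c\<^sup>2 = 9 * \<rho>\<^sup>2" by (simp add: c_def power_mult_distrib)
        ultimately have le: "c\<^sup>2 * t - c * X + - t * y\<^sup>2 \<le> - 3 * \<rho>\<^sup>2 * t + - (t / 4) * y\<^sup>2"
          unfolding c2 by (simp add: algebra_simps)
        have "\<bar>g y\<bar> \<le> exp (c\<^sup>2 * t - c * X) * exp (- t * y\<^sup>2)"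
          by (simp add: g_def abs_mult mult_le_cancel_left1 flip: mult.assoc)
        also have "\<dots> \<le> exp (- 3 * \<rho>\<^sup>2 * t) * exp (- (t / 4) * y\<^sup>2)"
          unfolding exp_add[symmetric] using le by simp
        finally show ?thesis using True y by simp
      qed (auto split: split_indicator)
    qed (use k in simp)
    then show ?thesis unfolding kv set_lebesgue_integral_def by simp
  qed
  have "pi * heat_kernel x t - Im (F (\<rho> * Complex 3 4) - F (of_real u)) = (LBINT y:{Y<..}. g y)"
  proof -
    have "\<rho> * Complex 3 4 = Complex c Y" by (simp add: complex_eq_iff c_def Y_def)
    moreover have "Complex c 0 = of_real c" by (simp add: complex_eq_iff)
    ultimately show ?thesis using g_half g_main split real_axis[of c] by simp
  qed
  then have "\<bar>pi * heat_kernel x t - Im (F (\<rho> * Complex 3 4) - F (of_real u))\<bar> \<le> exp (- 3 * \<rho>\<^sup>2 * t) * sqrt (pi / t)"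
    using tail by simp
  moreover have "heat_kernel x t - Im (F (\<rho> * Complex 3 4) - F (of_real u)) / pi
     = (pi * heat_kernel x t - Im (F (\<rho> * Complex 3 4) - F (of_real u))) / pi"
    by (simp add: field_simps)
  ultimately have "\<bar>heat_kernel x t - Im (F (\<rho> * Complex 3 4) - F (of_real u)) / pi\<bar>
     \<le> exp (- 3 * \<rho>\<^sup>2 * t) * sqrt (pi / t) / pi"
    by (simp only: abs_divide) (simp add: divide_right_mono)
  also have "\<dots> = exp (- 3 * \<rho>\<^sup>2 * t) / sqrt (pi * t)"
    using t by (simp add: real_sqrt_mult real_sqrt_divide field_simps)
  finally show ?thesis .
qed

subsection \<open>Quadrature along the contour\<close>

text \<open>The points run up the vertical line \<open>Re z = 3 \<mu>\<close> to \<open>\<mu> (3 + 4 \<i>)\<close> in eight steps and then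
  geometrically along the ray through \<open>3 + 4 \<i>\<close>. On the ray the discs scale with the distance from
  the origin, so they stay inside the sector where \<open>Re (z\<^sup>2) < 0 < Re z\<close>.\<close>

definition node :: "real \<Rightarrow> nat \<Rightarrow> complex" where
  "node \<mu> j = (if j \<le> 8 then of_real \<mu> * Complex 3 (j / 2) else of_real (\<mu> * (81/80) ^ (j - 8)) * Complex 3 4)"

text \<open>The radius belongs to the step from node \<open>j\<close> to node \<open>Suc j\<close>,
  so the corner \<open>j = 8\<close> already counts as part of the ray. On the vertical part,
  \<open>2 * \<mu>\<close> stays below the real part \<open>3 * \<mu>\<close>.\<close>

definition node_radius :: "real \<Rightarrow> nat \<Rightarrow> real" where
  "node_radius \<mu> j = (if j < 8 then 2 * \<mu> else \<mu> * (81/80) ^ (j - 8) / 4)"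

lemma node_ge_8: "j \<ge> 8 \<Longrightarrow> node \<mu> j = of_real (\<mu> * (81/80) ^ (j - 8)) * Complex 3 4"
  by (cases "j = 8") (auto simp: node_def)

lemma node_radius_pos: "\<mu> > 0 \<Longrightarrow> node_radius \<mu> j > 0"
  by (simp add: node_radius_def)

text \<open>The ratio 81/80 is tuned to this bound, since |3 + 4\<i>| / 80 = 1/16. A quarter is
  needed because samples lie at half the radius and the step may be at most half of that.\<close>

lemma node_step:
  assumes "\<mu> > 0"
  shows "cmod (node \<mu> (Suc j) - node \<mu> j) \<le> node_radius \<mu> j / 4"
proof (cases "j < 8")
  case True
  then have "node \<mu> (Suc j) - node \<mu> j = of_real (\<mu> / 2) * \<i>"
    by (simp add: node_def complex_eq_iff field_simps)
  then have "cmod (node \<mu> (Suc j) - node \<mu> j) = \<mu> / 2"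
    using assms by (simp only: norm_mult norm_of_real) simp
  then show ?thesis using True by (simp add: node_radius_def)
next
  case False
  define \<nu> where "\<nu> = \<mu> * (81/80) ^ (j - 8)"
  have \<nu>: "\<nu> > 0" using assms by (simp add: \<nu>_def)
  have j: "j \<ge> 8" "Suc j \<ge> 8" "Suc j - 8 = Suc (j - 8)" using False by auto
  have "node \<mu> (Suc j) = of_real (81/80 * \<nu>) * Complex 3 4" "node \<mu> j = of_real \<nu> * Complex 3 4"
    unfolding node_ge_8[OF j(1)] node_ge_8[OF j(2)] j(3) \<nu>_def by simp_all
  then have "node \<mu> (Suc j) - node \<mu> j = of_real (\<nu> / 80) * Complex 3 4"
    by (simp add: complex_eq_iff)
  moreover have "cmod (Complex 3 4) = 5"
    by (simp add: cmod_def)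
  ultimately have "cmod (node \<mu> (Suc j) - node \<mu> j) = \<nu> / 16"
    using \<nu> by (simp only: norm_mult norm_of_real)
  then show ?thesis using False by (simp add: node_radius_def flip: \<nu>_def)
qed

text \<open>On the vertical part the growth of Re \<open>z\<^sup>2\<close> is at most
  \<open>25 * \<mu>\<^sup>2\<close>; on the ray Re \<open>z\<^sup>2\<close> is negative of the order
  of the squared radius. Subtracting that square in both cases provides the Gaussian decay that
  makes the error per step uniform in \<open>j\<close>.\<close>

lemma node_disc:
  assumes \<mu>: "\<mu> > 0" and z: "z \<in> cball (node \<mu> j) (node_radius \<mu> j)"
  shows "Re z > 0" and "Re (z\<^sup>2) \<le> 30 * \<mu>\<^sup>2 - (node_radius \<mu> j)\<^sup>2"
proof -
  let ?d = "z - node \<mu> j"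
  have d: "\<bar>Re ?d\<bar> \<le> node_radius \<mu> j" "\<bar>Im ?d\<bar> \<le> node_radius \<mu> j"
    using z abs_Re_le_cmod[of ?d] abs_Im_le_cmod[of ?d] by (auto simp: dist_norm norm_minus_commute)
  have sq: "Re (z\<^sup>2) = (Re z)\<^sup>2 - (Im z)\<^sup>2" by (simp add: power2_eq_square)
  have "Re z > 0 \<and> Re (z\<^sup>2) \<le> 30 * \<mu>\<^sup>2 - (node_radius \<mu> j)\<^sup>2"
  proof (cases "j < 8")
    case True
    then have "\<bar>Re z - 3 * \<mu>\<bar> \<le> 2 * \<mu>" using d by (simp add: node_def node_radius_def)
    then have re: "Re z > 0" "Re z \<le> 5 * \<mu>" using \<mu> by linarith+
    then have "(Re z)\<^sup>2 \<le> (5 * \<mu>)\<^sup>2" by (intro power_mono) auto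
    then have "Re (z\<^sup>2) \<le> 25 * \<mu>\<^sup>2" unfolding sq by (simp add: power_mult_distrib)
      (use zero_le_power2[of "Im z"] in linarith)
    also have "\<dots> \<le> 30 * \<mu>\<^sup>2 - (2 * \<mu>)\<^sup>2" by (simp add: power_mult_distrib)
    finally show ?thesis using re True by (simp add: node_radius_def)
  next
    case False
    define \<nu> where "\<nu> = \<mu> * (81/80) ^ (j - 8)"
    have \<nu>: "\<nu> > 0" using \<mu> by (simp add: \<nu>_def)
    have r: "node_radius \<mu> j = \<nu> / 4" using False by (simp add: node_radius_def \<nu>_def)
    have "\<bar>Re z - 3 * \<nu>\<bar> \<le> \<nu> / 4" "\<bar>Im z - 4 * \<nu>\<bar> \<le> \<nu> / 4"
      using d False unfolding r by (simp_all add: node_ge_8 \<nu>_def mult_ac)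
    then have re: "Re z > 0" "Re z \<le> 13/4 * \<nu>" "Im z \<ge> 15/4 * \<nu>" using \<nu> by linarith+
    have "(Re z)\<^sup>2 \<le> (13/4 * \<nu>)\<^sup>2" using re by (intro power_mono) auto
    moreover have "(15/4 * \<nu>)\<^sup>2 \<le> (Im z)\<^sup>2" using re \<nu> by (intro power_mono) auto
    moreover have "(13/4 * \<nu>)\<^sup>2 = 169/16 * \<nu>\<^sup>2" "(15/4 * \<nu>)\<^sup>2 = 225/16 * \<nu>\<^sup>2" "(\<nu> / 4)\<^sup>2 = \<nu>\<^sup>2 / 16"
      by (simp_all add: power_mult_distrib power_divide)
    ultimately have "Re (z\<^sup>2) \<le> 30 * \<mu>\<^sup>2 - (\<nu> / 4)\<^sup>2"
      unfolding sq using zero_le_power2[of \<nu>] zero_le_power2[of \<mu>] by linarith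
    then show ?thesis using re unfolding r by simp
  qed
  then show "Re z > 0" and "Re (z\<^sup>2) \<le> 30 * \<mu>\<^sup>2 - (node_radius \<mu> j)\<^sup>2" by auto
qed

definition quad_node :: "real \<Rightarrow> nat \<Rightarrow> nat \<Rightarrow> nat \<Rightarrow> complex" where
  "quad_node \<mu> m j k = node \<mu> j + of_real (node_radius \<mu> j / 2) * cis (2 * pi * real k / m)"

lemma Re_quad_node_pos:
  assumes "\<mu> > 0" shows "Re (quad_node \<mu> m j k) > 0"
  by (rule node_disc(1)[OF assms, of _ j])
    (use node_radius_pos[OF assms, of j] in \<open>simp add: quad_node_def dist_norm norm_mult\<close>)

text \<open>Applied to radius times \<surd>t, this trades the length of a step for the factor
  1/\<surd>t.\<close>

lemma mult_exp_neg_square_le_1: "y * exp (- y\<^sup>2) \<le> (1::real)"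
proof -
  have "y \<le> 1 + y\<^sup>2" using zero_le_power2[of "y - 1/2"] by (simp add: power2_eq_square algebra_simps)
  also have "\<dots> \<le> exp (y\<^sup>2)" by (rule exp_ge_add_one_self)
  finally show ?thesis by (simp add: exp_minus field_simps)
qed

text \<open>The increment of \<open>F\<close> telescopes over the steps, each of which has the same
  error bound. The weights are fixed before \<open>F\<close>, \<open>t\<close> and \<open>X\<close>,
  so one choice serves all times and positions.\<close>

lemma contour_quadrature:
  fixes \<mu> :: real and m P :: nat
  assumes \<mu>: "\<mu> > 0" and m: "m > 0"
  obtains W :: "nat \<Rightarrow> nat \<Rightarrow> complex"
  where "\<And>F t X. t > 0 \<Longrightarrow> X \<ge> 0 \<Longrightarrow>
      (\<And>z. (F has_field_derivative exp (z\<^sup>2 * of_real t - z * of_real X)) (at z)) \<Longrightarrow>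
      cmod (F (node \<mu> P) - F (node \<mu> 0)
        - (\<Sum>j<P. \<Sum>k<m. W j k * exp ((quad_node \<mu> m j k)\<^sup>2 * of_real t - quad_node \<mu> m j k * of_real X)))
      \<le> 3 / 2 * real P * exp (30 * \<mu>\<^sup>2 * t) / (sqrt t * 2 ^ m)"
proof -
  let ?R = "node_radius \<mu>"
  define good where "good j w \<longleftrightarrow> (\<forall>f F M. f holomorphic_on cball (node \<mu> j) (?R j) \<longrightarrow>
           (\<forall>\<zeta>\<in>cball (node \<mu> j) (?R j). (F has_field_derivative f \<zeta>) (at \<zeta>)) \<longrightarrow>
           (\<forall>\<zeta>\<in>cball (node \<mu> j) (?R j). cmod (f \<zeta>) \<le> M) \<longrightarrow>
           cmod (F (node \<mu> (Suc j)) - F (node \<mu> j) - (\<Sum>k<m. w k * f (quad_node \<mu> m j k)))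
             \<le> 6 * cmod (node \<mu> (Suc j) - node \<mu> j) * M / 2 ^ m)"
    for j and w :: "nat \<Rightarrow> complex"
  have "\<exists>w. good j w" for j
  proof -
    \<comment> \<open>The disc rule is used with half the node radius, so that its disc of
      holomorphy is exactly the node disc.\<close>
    have R: "2 * (?R j / 2) = ?R j" and b: "node \<mu> j + (node \<mu> (Suc j) - node \<mu> j) = node \<mu> (Suc j)"
      by simp_all
    have "?R j / 2 > 0" "cmod (node \<mu> (Suc j) - node \<mu> j) \<le> ?R j / 2 / 2"
      using node_step[OF \<mu>, of j] node_radius_pos[OF \<mu>, of j] by simp_all
    from disc_quadrature[OF m this, of "node \<mu> j"] show ?thesis
      unfolding good_def R b quad_node_def .
  qed
  then obtain W where "\<And>j. good j (W j)" by metis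
  then have W: "cmod (F (node \<mu> (Suc j)) - F (node \<mu> j) - (\<Sum>k<m. W j k * f (quad_node \<mu> m j k)))
             \<le> 6 * cmod (node \<mu> (Suc j) - node \<mu> j) * M / 2 ^ m"
    if "f holomorphic_on cball (node \<mu> j) (?R j)"
      and "\<And>\<zeta>. \<zeta> \<in> cball (node \<mu> j) (?R j) \<Longrightarrow> (F has_field_derivative f \<zeta>) (at \<zeta>)"
      and "\<And>\<zeta>. \<zeta> \<in> cball (node \<mu> j) (?R j) \<Longrightarrow> cmod (f \<zeta>) \<le> M" for j f F M
    using that unfolding good_def by blast
  show ?thesis
  proof (rule that[of W])
    fix F :: "complex \<Rightarrow> complex" and t X :: real
    assume t: "t > 0" and X: "X \<ge> 0"
      and F: "\<And>z. (F has_field_derivative exp (z\<^sup>2 * of_real t - z * of_real X)) (at z)"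
    define f where "f z = exp (z\<^sup>2 * of_real t - z * of_real X)" for z :: complex
    have piece: "cmod (F (node \<mu> (Suc j)) - F (node \<mu> j) - (\<Sum>k<m. W j k * f (quad_node \<mu> m j k)))
       \<le> 3 / 2 * exp (30 * \<mu>\<^sup>2 * t) / (sqrt t * 2 ^ m)" for j
    proof -
      have R: "?R j > 0" using node_radius_pos[OF \<mu>] .
      have "cmod (F (node \<mu> (Suc j)) - F (node \<mu> j) - (\<Sum>k<m. W j k * f (quad_node \<mu> m j k)))
         \<le> 6 * cmod (node \<mu> (Suc j) - node \<mu> j) * exp ((30 * \<mu>\<^sup>2 - (?R j)\<^sup>2) * t) / 2 ^ m"
      proof (rule W)
        show "f holomorphic_on cball (node \<mu> j) (?R j)"
          unfolding f_def by (intro holomorphic_intros)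
        show "(F has_field_derivative f \<zeta>) (at \<zeta>)" for \<zeta> using F by (simp add: f_def)
        fix \<zeta> assume \<zeta>: "\<zeta> \<in> cball (node \<mu> j) (?R j)"
        have "Re (\<zeta>\<^sup>2) * t - Re \<zeta> * X \<le> (30 * \<mu>\<^sup>2 - (?R j)\<^sup>2) * t"
          using mult_right_mono[OF node_disc(2)[OF \<mu> \<zeta>] less_imp_le[OF t]]
            mult_nonneg_nonneg[OF less_imp_le[OF node_disc(1)[OF \<mu> \<zeta>]] X] by linarith
        then show "cmod (f \<zeta>) \<le> exp ((30 * \<mu>\<^sup>2 - (?R j)\<^sup>2) * t)"
          unfolding f_def norm_exp_eq_Re by simp
      qed
      also have "\<dots> \<le> 6 * (?R j / 4) * exp ((30 * \<mu>\<^sup>2 - (?R j)\<^sup>2) * t) / 2 ^ m"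
        by (intro divide_right_mono mult_right_mono mult_left_mono node_step \<mu>) auto
      also have "exp ((30 * \<mu>\<^sup>2 - (?R j)\<^sup>2) * t) = exp (30 * \<mu>\<^sup>2 * t) * exp (- (?R j * sqrt t)\<^sup>2)"
        using t by (simp flip: exp_add add: power_mult_distrib algebra_simps)
      also have "6 * (?R j / 4) * (exp (30 * \<mu>\<^sup>2 * t) * exp (- (?R j * sqrt t)\<^sup>2)) / 2 ^ m
          = 3 / 2 * exp (30 * \<mu>\<^sup>2 * t) / (sqrt t * 2 ^ m) * ((?R j * sqrt t) * exp (- (?R j * sqrt t)\<^sup>2))"
        using t by (simp add: field_simps)
      also have "\<dots> \<le> 3 / 2 * exp (30 * \<mu>\<^sup>2 * t) / (sqrt t * 2 ^ m) * 1"
        using t by (intro mult_left_mono mult_exp_neg_square_le_1) auto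
      finally show ?thesis by simp
    qed
    have "F (node \<mu> P) - F (node \<mu> 0) = (\<Sum>j<P. F (node \<mu> (Suc j)) - F (node \<mu> j))"
      by (rule sum_lessThan_telescope[symmetric])
    then have "F (node \<mu> P) - F (node \<mu> 0) - (\<Sum>j<P. \<Sum>k<m. W j k * f (quad_node \<mu> m j k))
       = (\<Sum>j<P. F (node \<mu> (Suc j)) - F (node \<mu> j) - (\<Sum>k<m. W j k * f (quad_node \<mu> m j k)))"
      by (simp add: sum_subtractf)
    also have "cmod \<dots> \<le> (\<Sum>j<P. 3 / 2 * exp (30 * \<mu>\<^sup>2 * t) / (sqrt t * 2 ^ m))"
      by (intro sum_norm_le piece)
    finally show "cmod (F (node \<mu> P) - F (node \<mu> 0)
        - (\<Sum>j<P. \<Sum>k<m. W j k * exp ((quad_node \<mu> m j k)\<^sup>2 * of_real t - quad_node \<mu> m j k * of_real X)))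
      \<le> 3 / 2 * real P * exp (30 * \<mu>\<^sup>2 * t) / (sqrt t * 2 ^ m)"
      unfolding f_def by (simp add: mult_ac)
  qed
qed

section \<open>Assembling conjugate pairs of nodes into the approximate kernel\<close>

lemma sum_symmetric_int:
  fixes f :: "int \<Rightarrow> 'a :: comm_monoid_add"
  shows "(\<Sum>k\<in>{- int n..int n}. f k) = f 0 + (\<Sum>i<n. f (int (Suc i)) + f (- int (Suc i)))"
proof (induction n)
  case (Suc n)
  have "{- int (Suc n)..int (Suc n)} = insert (int (Suc n)) (insert (- int (Suc n)) {- int n..int n})"
    by auto
  then show ?case using Suc by (simp add: add_ac)
qed simp

text \<open>The principal root of \<open>z\<^sup>2\<close> is \<open>z\<close> itself, whereas a
  nonpositive real has a purely imaginary root.\<close>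

lemma square_notin_nonpos_Reals:
  assumes "Re z > 0" shows "z\<^sup>2 \<notin> complex_of_real ` {..0}"
proof
  assume "z\<^sup>2 \<in> complex_of_real ` {..0}"
  then have "csqrt (z\<^sup>2) = \<i> * sqrt (- Re (z\<^sup>2))" by (auto simp: csqrt_of_real_nonpos)
  then show False using assms by (simp add: csqrt_square complex_eq_iff)
qed

lemma sum_div_mod:
  fixes g :: "nat \<Rightarrow> nat \<Rightarrow> 'a :: comm_monoid_add"
  assumes "m > 0"
  shows "(\<Sum>i<P * m. g (i div m) (i mod m)) = (\<Sum>j<P. \<Sum>k<m. g j k)"
proof -
  have "(\<Sum>i<P * m. g (i div m) (i mod m)) = (\<Sum>j<P. \<Sum>i\<in>{j * m..<j * m + m}. g (i div m) (i mod m))"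
    by (rule sum.nat_group[symmetric])
  also have "\<dots> = (\<Sum>j<P. \<Sum>k<m. g j k)"
  proof (rule sum.cong[OF refl])
    fix j
    have "(\<Sum>i\<in>{j * m..<j * m + m}. g (i div m) (i mod m)) = (\<Sum>k\<in>{0..<m}. g ((k + j * m) div m) ((k + j * m) mod m))"
      using sum.shift_bounds_nat_ivl[of "\<lambda>i. g (i div m) (i mod m)" 0 "j * m" m] by (simp add: add.commute)
    also have "\<dots> = (\<Sum>k<m. g j k)"
      by (rule sum.cong) auto
    finally show "(\<Sum>i\<in>{j * m..<j * m + m}. g (i div m) (i mod m)) = (\<Sum>k<m. g j k)" .
  qed
  finally show ?thesis .
qed

lemma heat_kernel_primitive:
  obtains F where "\<And>z::complex. (F has_field_derivative exp (z\<^sup>2 * of_real t - z * of_real X)) (at z)"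
proof -
  have "(\<lambda>z. exp (z\<^sup>2 * of_real t - z * of_real X)) holomorphic_on UNIV"
    by (intro holomorphic_intros)
  from holomorphic_convex_primitive'[OF convex_UNIV open_UNIV this] show ?thesis
    using that by auto
qed

text \<open>The heat kernel is close to Im \<open>D\<close> / \<pi> for the increment
  \<open>D\<close> of a primitive, and Im S / \<pi> is S / (2 \<pi> \<i>) plus its conjugate.
  Positive indices therefore carry the quadrature sum and negative indices its conjugate.\<close>

lemma approx_kernel_error:
  fixes \<mu> :: real and N m :: nat
  assumes \<mu>: "\<mu> > 0" and m: "m > 0"
  shows "\<exists>w s. (\<forall>k\<in>{- int ((N + 8) * m)..int ((N + 8) * m)}. s k \<notin> complex_of_real ` {..0}) \<and>
     (\<forall>x t. t > 0 \<longrightarrow> cmod (complex_of_real (heat_kernel x t) - approx_kernel ((N + 8) * m) w s x t)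
        \<le> (exp (- 3 * (\<mu> * (81/80) ^ N)\<^sup>2 * t) + real (N + 8) * exp (30 * \<mu>\<^sup>2 * t) / 2 ^ (Suc m)) / sqrt t)"
proof -
  let ?P = "N + 8" and ?Q = "quad_node \<mu> m"
  obtain W :: "nat \<Rightarrow> nat \<Rightarrow> complex" where W: "\<And>F t X. t > 0 \<Longrightarrow> X \<ge> 0 \<Longrightarrow>
      (\<And>z. (F has_field_derivative exp (z\<^sup>2 * of_real t - z * of_real X)) (at z)) \<Longrightarrow>
      cmod (F (node \<mu> ?P) - F (node \<mu> 0)
        - (\<Sum>j<?P. \<Sum>k<m. W j k * exp ((?Q j k)\<^sup>2 * of_real t - ?Q j k * of_real X)))
      \<le> 3 / 2 * real ?P * exp (30 * \<mu>\<^sup>2 * t) / (sqrt t * 2 ^ m)"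
    using contour_quadrature[OF \<mu> m] by blast
  \<comment> \<open>Indices start at 1, hence the shift before splitting into step and
    sample.\<close>
  define z where "z i = ?Q ((i - 1) div m) ((i - 1) mod m)" for i :: nat
  define v where "v i = W ((i - 1) div m) ((i - 1) mod m) / (2 * pi * \<i>)" for i :: nat
  \<comment> \<open>The index 0 is filled by a dummy node 1 of positive real part with weight 0. The
    actual nodes are the squares of \<open>y\<close>, whose principal roots are again
    \<open>y\<close>.\<close>
  define y where "y k = (if k = 0 then 1 else if k > 0 then z (nat k) else cnj (z (nat (- k))))" for k :: int
  define w where "w k = (if k = 0 then 0 else if k > 0 then v (nat k) else cnj (v (nat (- k))))" for k :: int
  have y: "Re (y k) > 0" for k
    using Re_quad_node_pos[OF \<mu>] by (auto simp: y_def z_def)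
  show ?thesis
  proof (rule exI[of _ w], rule exI[of _ "\<lambda>k. (y k)\<^sup>2"], intro conjI ballI allI impI)
    show "(y k)\<^sup>2 \<notin> complex_of_real ` {..0}" for k
      by (rule square_notin_nonpos_Reals[OF y])
    fix x t :: real assume t: "t > 0"
    define X where "X = \<bar>x\<bar>"
    have X: "X \<ge> 0" by (simp add: X_def)
    obtain F where F: "\<And>z::complex. (F has_field_derivative exp (z\<^sup>2 * of_real t - z * of_real X)) (at z)"
      using heat_kernel_primitive by blast
    define S where "S = (\<Sum>j<?P. \<Sum>k<m. W j k * exp ((?Q j k)\<^sup>2 * of_real t - ?Q j k * of_real X))"
    define D where "D = F (node \<mu> ?P) - F (node \<mu> 0)"
    have "approx_kernel (?P * m) w (\<lambda>k. (y k)\<^sup>2) x t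
       = (\<Sum>k\<in>{- int (?P * m)..int (?P * m)}. w k * exp ((y k)\<^sup>2 * of_real t - y k * of_real X))"
      unfolding approx_kernel_def using y
      by (intro sum.cong refl) (simp add: csqrt_square X_def exp_diff exp_minus field_simps)
    also have "\<dots> = (\<Sum>i<?P * m. v (Suc i) * exp ((z (Suc i))\<^sup>2 * of_real t - z (Suc i) * of_real X)
        + cnj (v (Suc i) * exp ((z (Suc i))\<^sup>2 * of_real t - z (Suc i) * of_real X)))"
      unfolding sum_symmetric_int by (simp add: w_def y_def exp_cnj nat_add_distrib del: of_nat_Suc)
    also have "\<dots> = S / (2 * pi * \<i>) + cnj (S / (2 * pi * \<i>))"
    proof -
      have "(\<Sum>i<?P * m. v (Suc i) * exp ((z (Suc i))\<^sup>2 * of_real t - z (Suc i) * of_real X)) = S / (2 * pi * \<i>)"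
        unfolding S_def sum_div_mod[OF m, symmetric] sum_divide_distrib by (simp add: v_def z_def)
      then show ?thesis by (simp only: sum.distrib cnj_sum[symmetric])
    qed
    also have "\<dots> = of_real (Im S / pi)"
      by (simp add: complex_add_cnj) (simp add: complex_eq_iff Re_divide Im_divide power2_eq_square)
    finally have A: "approx_kernel (?P * m) w (\<lambda>k. (y k)\<^sup>2) x t = of_real (Im S / pi)" .
    have node0: "node \<mu> 0 = of_real (3 * \<mu>)" and nodeP: "node \<mu> ?P = of_real (\<mu> * (81/80) ^ N) * Complex 3 4"
      by (simp_all add: node_def node_ge_8 complex_eq_iff)
    have tail: "\<bar>heat_kernel x t - Im D / pi\<bar> \<le> exp (- 3 * (\<mu> * (81/80) ^ N)\<^sup>2 * t) / sqrt (pi * t)"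
      unfolding D_def node0 nodeP using t \<mu> F unfolding X_def by (intro heat_kernel_tail) auto
    have "\<bar>Im D - Im S\<bar> \<le> cmod (D - S)" using abs_Im_le_cmod[of "D - S"] by simp
    also have "\<dots> \<le> 3 / 2 * real ?P * exp (30 * \<mu>\<^sup>2 * t) / (sqrt t * 2 ^ m)"
      unfolding D_def S_def by (rule W[OF t X F])
    \<comment> \<open>Bounding \<pi> below by 3 turns 3/2 into 1/2, which accounts for the exponent
      \<open>Suc m\<close>.\<close>
    finally have "\<bar>Im D - Im S\<bar> / pi \<le> 3 / 2 * real ?P * exp (30 * \<mu>\<^sup>2 * t) / (sqrt t * 2 ^ m) / 3"
      using pi_gt3 t by (intro frac_le) auto
    also have "3 / 2 * a * b / (c * d) / 3 = a * b / (2 * d) / c" for a b c d :: real by simp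
    also note power_Suc[symmetric]
    finally have quad: "\<bar>Im D / pi - Im S / pi\<bar> \<le> real ?P * exp (30 * \<mu>\<^sup>2 * t) / 2 ^ Suc m / sqrt t"
      by (simp flip: diff_divide_distrib)
    have "exp (- 3 * (\<mu> * (81/80) ^ N)\<^sup>2 * t) / sqrt (pi * t) \<le> exp (- 3 * (\<mu> * (81/80) ^ N)\<^sup>2 * t) / sqrt t"
      using t pi_gt3 by (intro divide_left_mono) auto
    then have "\<bar>heat_kernel x t - Im S / pi\<bar> \<le> exp (- 3 * (\<mu> * (81/80) ^ N)\<^sup>2 * t) / sqrt t
        + real ?P * exp (30 * \<mu>\<^sup>2 * t) / 2 ^ Suc m / sqrt t"
      using tail quad by linarith
    then show "cmod (complex_of_real (heat_kernel x t) - approx_kernel (?P * m) w (\<lambda>k. (y k)\<^sup>2) x t)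
        \<le> (exp (- 3 * (\<mu> * (81/80) ^ N)\<^sup>2 * t) + real ?P * exp (30 * \<mu>\<^sup>2 * t) / 2 ^ (Suc m)) / sqrt t"
      unfolding A of_real_diff[symmetric] norm_of_real add_divide_distrib .
  qed
qed

section \<open>Choice of the parameters and count of the nodes\<close>

lemma heat_kernel_approximation:
  fixes \<epsilon> \<delta> T :: real
  assumes \<epsilon>: "0 < \<epsilon>" "\<epsilon> < 0.1" and \<delta>: "0 < \<delta>" and T: "1000 * \<delta> \<le> T"
  shows "\<exists>n::nat. 0 < n \<and> real n \<le> 10000 * ln (T / \<delta>) * (ln (1 / \<epsilon>) + ln (ln (T / \<delta>))) \<and>
            (\<exists>w s :: int \<Rightarrow> complex.
               (\<forall>k\<in>{- int n..int n}. s k \<notin> complex_of_real ` {..0}) \<and>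
               (\<forall>x t. \<delta> \<le> t \<and> t \<le> T \<longrightarrow>
                  cmod (complex_of_real (heat_kernel x t) - approx_kernel n w s x t) < \<epsilon> / sqrt t))"
proof -
  define L \<Lambda> where "L = ln (1 / \<epsilon>)" and "\<Lambda> = ln (T / \<delta>)"
  have T0: "T > 0" using \<delta> T by simp
  have e3: "exp 1 \<le> (3::real)" by (rule exp_le)
  have \<epsilon>L: "\<epsilon> = exp (- L)" using \<epsilon> by (simp add: L_def ln_div)
  have "3 \<le> 1 / \<epsilon>" using \<epsilon> by (simp add: field_simps)
  then have "exp 1 \<le> 1 / \<epsilon>" using e3 by linarith
  then have L: "L \<ge> 1" unfolding L_def using \<epsilon> by (subst ln_ge_iff) auto
  have "3 \<le> T / \<delta>" using \<delta> T by (simp add: field_simps)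
  then have "exp 1 \<le> T / \<delta>" using e3 by linarith
  then have \<Lambda>: "\<Lambda> \<ge> 1" unfolding \<Lambda>_def using \<delta> T0 by (subst ln_ge_iff) auto
  have ln\<Lambda>: "ln \<Lambda> \<ge> 0" using \<Lambda> by simp
  \<comment> \<open>This keeps \<open>\<mu>\<^sup>2 * t\<close> below \<open>L\<close> for all
    \<open>t \<le> T\<close>, so the integrand grows at most like
    \<open>exp (30 * L)\<close>.\<close>
  define \<mu> where "\<mu> = sqrt (L / T)"
  have \<mu>: "\<mu> > 0" "\<mu>\<^sup>2 = L / T" using L T0 by (auto simp: \<mu>_def)
  \<comment> \<open>Since \<open>ln (81/80) \<ge> 1/81\<close>, about \<open>41 * \<Lambda>\<close>
    steps let the squared growth factor of the ray reach \<open>T / \<delta>\<close>.\<close>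
  define N where "N = nat \<lceil>41 * \<Lambda>\<rceil>"
  have N: "41 * \<Lambda> \<le> N" "N \<le> 41 * \<Lambda> + 1" using \<Lambda> by (auto simp: N_def of_nat_ceiling)
  define P where "P = N + 8"
  have P: "real P \<le> 50 * \<Lambda>" "P > 0" using N \<Lambda> by (auto simp: P_def)
  \<comment> \<open>The aim is \<open>2 ^ m \<ge> P * exp (31 * L)\<close>: 30 for the growth of the
    integrand, 1 for the factor \<epsilon>, and the factor 2 because
    \<open>ln 2 \<ge> 1/2\<close>.\<close>
  define m where "m = nat \<lceil>2 * (31 * L + ln P)\<rceil>"
  have lnP0: "ln P \<ge> 0" using P by simp
  have m: "2 * (31 * L + ln P) \<le> m" "m \<le> 2 * (31 * L + ln P) + 1"
    using L lnP0 by (auto simp: m_def of_nat_ceiling)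
  have "real m > 0" using m(1) L lnP0 by (simp add: algebra_simps)
  then have m0: "m > 0" by simp
  have "ln P \<le> ln (50 * \<Lambda>)" using P \<Lambda> by (subst ln_le_cancel_iff) auto
  also have "\<dots> = ln 50 + ln \<Lambda>" using \<Lambda> by (simp add: ln_mult)
  also have "ln 50 \<le> (49 :: real)" using ln_le_minus_one[of 50] by simp
  finally have lnP: "ln P \<le> 49 + ln \<Lambda>" by simp
  have m_le: "real m \<le> 200 * (L + ln \<Lambda>)" using m(2) lnP L ln\<Lambda> by (simp add: algebra_simps)
  have n_le: "real (P * m) \<le> 10000 * \<Lambda> * (L + ln \<Lambda>)"
  proof -
    have "real (P * m) \<le> (50 * \<Lambda>) * (200 * (L + ln \<Lambda>))"
      unfolding of_nat_mult using P(1) m_le \<Lambda> by (intro mult_mono) auto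
    then show ?thesis by (simp add: mult_ac)
  qed
  have pow_m: "real P * exp (31 * L) \<le> 2 ^ m"
  proof -
    have "real P * exp (31 * L) = exp (31 * L + ln P)" using P by (simp add: exp_add)
    also have "\<dots> \<le> exp (real m * ln 2)"
    proof -
      have "1 / 2 \<le> ln (2::real)" using ln2_ge_two_thirds by simp
      then have "real m * (1 / 2) \<le> real m * ln 2" by (intro mult_left_mono) auto
      then show ?thesis using m(1) by simp
    qed
    also have "\<dots> = 2 ^ m" by (simp add: exp_of_nat_mult)
    finally show ?thesis .
  qed
  have pow_N: "T / \<delta> \<le> ((81/80) ^ N)\<^sup>2"
  proof -
    have "1 / 81 \<le> ln (81/80 :: real)"
      using ln_le_minus_one[of "80/81"] by (simp add: ln_div)
    then have "real (2 * N) * (1 / 81) \<le> real (2 * N) * ln (81/80)" by (intro mult_left_mono) auto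
    moreover have "\<Lambda> \<le> real (2 * N) * (1 / 81)" using N(1) \<Lambda> by simp
    ultimately have "\<Lambda> \<le> real (2 * N) * ln (81/80)" by linarith
    then have "exp \<Lambda> \<le> exp (real (2 * N) * ln (81/80))" by simp
    also have "\<dots> = (81/80) ^ (2 * N)" by (simp only: exp_of_nat_mult) simp
    finally show ?thesis using T0 \<delta> by (simp add: \<Lambda>_def power_mult mult.commute flip: power_mult)
  qed
  obtain w s where ws: "\<forall>k\<in>{- int (P * m)..int (P * m)}. s k \<notin> complex_of_real ` {..0}"
    "\<And>x t. t > 0 \<Longrightarrow> cmod (complex_of_real (heat_kernel x t) - approx_kernel (P * m) w s x t)
        \<le> (exp (- 3 * (\<mu> * (81/80) ^ N)\<^sup>2 * t) + real P * exp (30 * \<mu>\<^sup>2 * t) / 2 ^ (Suc m)) / sqrt t"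
    using approx_kernel_error[OF \<mu>(1) m0, of N] unfolding P_def by metis
  have "cmod (complex_of_real (heat_kernel x t) - approx_kernel (P * m) w s x t) < \<epsilon> / sqrt t"
    if t: "\<delta> \<le> t" "t \<le> T" for x t
  proof -
    have t0: "t > 0" using t \<delta> by simp
    have "L \<le> (\<mu> * (81/80) ^ N)\<^sup>2 * t"
    proof -
      have "L = L / T * (T / \<delta>) * \<delta>" using T0 \<delta> by simp
      also have "\<dots> \<le> L / T * ((81/80) ^ N)\<^sup>2 * t"
        using L T0 \<delta> t pow_N by (intro mult_mono) auto
      finally show ?thesis by (simp add: power_mult_distrib \<mu>(2))
    qed
    \<comment> \<open>One of the three available powers of \<epsilon> is given away;
      \<open>\<epsilon> * \<epsilon> < \<epsilon> / 2\<close> follows from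
      \<open>\<epsilon> < 0.1\<close> and makes the final inequality strict.\<close>
    then have "exp (- 3 * (\<mu> * (81/80) ^ N)\<^sup>2 * t) \<le> exp (- L + - L)" using L by simp
    also have "\<dots> = \<epsilon> * \<epsilon>" unfolding exp_add \<epsilon>L ..
    also have "\<dots> < \<epsilon> / 2" using \<epsilon> by (simp add: field_simps)
    finally have e1: "exp (- 3 * (\<mu> * (81/80) ^ N)\<^sup>2 * t) < \<epsilon> / 2" .
    have "\<mu>\<^sup>2 * t \<le> L" using L t T0 by (simp add: \<mu>(2) field_simps mult_left_mono)
    then have "exp (30 * \<mu>\<^sup>2 * t) \<le> exp (31 * L) * \<epsilon>" unfolding \<epsilon>L exp_add[symmetric] by simp
    then have "real P * exp (30 * \<mu>\<^sup>2 * t) \<le> (real P * exp (31 * L)) * \<epsilon>" by (simp add: mult_left_mono mult.assoc)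
    also have "\<dots> \<le> 2 ^ m * \<epsilon>" using \<epsilon> by (intro mult_right_mono pow_m) auto
    finally have e2: "real P * exp (30 * \<mu>\<^sup>2 * t) / 2 ^ Suc m \<le> \<epsilon> / 2" by (simp add: field_simps)
    have "(exp (- 3 * (\<mu> * (81/80) ^ N)\<^sup>2 * t) + real P * exp (30 * \<mu>\<^sup>2 * t) / 2 ^ Suc m) / sqrt t < \<epsilon> / sqrt t"
      using add_less_le_mono[OF e1 e2] t0 by (intro divide_strict_right_mono) auto
    with ws(2)[OF t0] show ?thesis by (rule order_le_less_trans)
  qed
  moreover have "P * m > 0" using P m0 by simp
  ultimately show ?thesis using n_le ws(1) unfolding L_def \<Lambda>_def by blast
qed

theorem theorem1:
  shows "(\<forall>s>0. \<forall>x. heat_kernel_laplace x s = exp (- sqrt s * \<bar>x\<bar>) / (2 * sqrt s))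
    \<and> (\<exists>C>0. \<forall>\<epsilon> \<delta> T::real. 0 < \<epsilon> \<and> \<epsilon> < 0.1 \<and> 0 < \<delta> \<and> 1000 * \<delta> \<le> T \<longrightarrow>
         (\<exists>n::nat. 0 < n \<and> real n \<le> C * ln (T / \<delta>) * (ln (1 / \<epsilon>) + ln (ln (T / \<delta>))) \<and>
            (\<exists>w s :: int \<Rightarrow> complex.
               (\<forall>k\<in>{- int n..int n}. s k \<notin> complex_of_real ` {..0}) \<and>
               (\<forall>x t. \<delta> \<le> t \<and> t \<le> T \<longrightarrow>
                  cmod (complex_of_real (heat_kernel x t) - approx_kernel n w s x t) < \<epsilon> / sqrt t))))"
proof (rule conjI)
  show "\<forall>s>0. \<forall>x. heat_kernel_laplace x s = exp (- sqrt s * \<bar>x\<bar>) / (2 * sqrt s)"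
    using heat_kernel_laplace_eq by blast
qed (rule exI[of _ 10000], rule conjI, simp, intro allI impI, elim conjE, rule heat_kernel_approximation)

end
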